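(* Let $N$ be a loop, $H$ a group, $\phi:H\to Sym(N)_1$ a group homomorphism, and $L=N\rtimes_\phi H$. Then the right nucleus of $L$ is $$N_\rho(L)=\{(x,y)\in N\times H\mid \phi_h(n\phi_{h'}(x))=\phi_h(n)\phi_{hh'}(x)\ \text{and}\ \phi_h(x)\in N_\rho(N)\ \text{for all } h,h'\in H,\ n\in N\}.$$
   Context: A loop is a non-empty set with a binary operation such that for all $a,b$ the equations $xa=b$ and $ax=b$ have unique solutions, and there is a two-sided identity $1$. $Sym(N)_1$ is the stabilizer of $1$ in the group of permutations of $N$; write $\phi_h=\phi(h)$. $N\rtimes_\phi H$ is the loop on $N\times H$ with operation $(n_1,h_1)(n_2,h_2)=(n_1\phi_{h_1}(n_2),h_1h_2)$. For a loop $Q$, the right nucleus is $N_\rho(Q)=\{a\in Q\mid x(ya)=(xy)a\ \forall x,y\in Q\}$. *)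

theory Defs
  imports "HOL-Algebra.Bij" "HOL-Algebra.Group_Action"
begin

locale loop =
  fixes Q (structure)
  assumes m_closed [intro, simp]:
      "\<lbrakk>x \<in> carrier Q; y \<in> carrier Q\<rbrakk> \<Longrightarrow> x \<otimes> y \<in> carrier Q"
    and one_closed [intro, simp]: "\<one> \<in> carrier Q"
    and l_one [simp]: "x \<in> carrier Q \<Longrightarrow> \<one> \<otimes> x = x"
    and r_one [simp]: "x \<in> carrier Q \<Longrightarrow> x \<otimes> \<one> = x"
    and l_div: "\<lbrakk>a \<in> carrier Q; b \<in> carrier Q\<rbrakk> \<Longrightarrow> \<exists>!x. x \<in> carrier Q \<and> a \<otimes> x = b"
    and r_div: "\<lbrakk>a \<in> carrier Q; b \<in> carrier Q\<rbrakk> \<Longrightarrow> \<exists>!x. x \<in> carrier Q \<and> x \<otimes> a = b"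

definition right_nucleus :: "('a, 'm) monoid_scheme \<Rightarrow> 'a set" where
  "right_nucleus Q = {a \<in> carrier Q. \<forall>x\<in>carrier Q. \<forall>y\<in>carrier Q.
     x \<otimes>\<^bsub>Q\<^esub> (y \<otimes>\<^bsub>Q\<^esub> a) = (x \<otimes>\<^bsub>Q\<^esub> y) \<otimes>\<^bsub>Q\<^esub> a}"

(* Sym(N)_1. As in BijGroup, permutations are extensional functions on the carrier,
   multiplied by (f g)(x) = f (g x). *)
definition Sym_one :: "('a, 'm) monoid_scheme \<Rightarrow> ('a \<Rightarrow> 'a) monoid" where
  "Sym_one N = (BijGroup (carrier N))
     \<lparr>carrier := stabilizer (BijGroup (carrier N)) (\<lambda>f. f) \<one>\<^bsub>N\<^esub>\<rparr>"

definition semidirect ::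
  "('a, 'm) monoid_scheme \<Rightarrow> ('h \<Rightarrow> 'a \<Rightarrow> 'a) \<Rightarrow> ('h, 'k) monoid_scheme \<Rightarrow> ('a \<times> 'h) monoid" where
  "semidirect N \<phi> H =
     \<lparr>carrier = carrier N \<times> carrier H,
      mult = (\<lambda>(n\<^sub>1, h\<^sub>1) (n\<^sub>2, h\<^sub>2). (n\<^sub>1 \<otimes>\<^bsub>N\<^esub> \<phi> h\<^sub>1 n\<^sub>2, h\<^sub>1 \<otimes>\<^bsub>H\<^esub> h\<^sub>2)),
      one = (\<one>\<^bsub>N\<^esub>, \<one>\<^bsub>H\<^esub>)\<rparr>"

lemma group_Sym_one:
  assumes "loop N"
  shows "group (Sym_one N)"
proof -
  interpret loop N by fact
  interpret B: group "BijGroup (carrier N)" by (rule group_BijGroup)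
  have "(\<lambda>f. f) \<in> hom (BijGroup (carrier N)) (BijGroup (carrier N))"
    by (simp add: hom_def)
  then have "group_action (BijGroup (carrier N)) (carrier N) (\<lambda>f. f)"
    unfolding group_action_def group_hom_def group_hom_axioms_def
    by (simp add: group_BijGroup)
  then have "subgroup (stabilizer (BijGroup (carrier N)) (\<lambda>f. f) \<one>\<^bsub>N\<^esub>) (BijGroup (carrier N))"
    by (rule group_action.stabilizer_subgroup) simp
  then show ?thesis
    unfolding Sym_one_def by (rule B.subgroup_imp_group)
qed

lemma carrier_Sym_one:
  assumes "loop N"
  shows "carrier (Sym_one N) = {f \<in> Bij (carrier N). f \<one>\<^bsub>N\<^esub> = \<one>\<^bsub>N\<^esub>}"
  by (simp add: Sym_one_def stabilizer_def BijGroup_def)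

lemma loop_semidirect:
  assumes "loop N" and "group H" and \<phi>: "\<phi> \<in> hom H (Sym_one N)"
  shows "loop (semidirect N \<phi> H)"
proof -
  interpret N: loop N by fact
  interpret H: group H by fact
  interpret S: group "Sym_one N" by (rule group_Sym_one) fact
  interpret \<phi>: group_hom H "Sym_one N" \<phi>
    by unfold_locales (fact \<phi>)
  have mem: "\<phi> h \<in> Bij (carrier N)" and fix1 [simp]: "\<phi> h \<one>\<^bsub>N\<^esub> = \<one>\<^bsub>N\<^esub>"
    if "h \<in> carrier H" for h
    using \<phi>.hom_closed[OF that] carrier_Sym_one[OF assms(1)] by auto
  have bij: "bij_betw (\<phi> h) (carrier N) (carrier N)" if "h \<in> carrier H" for h
    using mem[OF that] by (simp add: Bij_def)
  have clo [simp]: "\<phi> h n \<in> carrier N" if "h \<in> carrier H" "n \<in> carrier N" for h n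
    using bij[OF that(1)] that(2) by (rule bij_betwE[rule_format])
  have one [simp]: "\<one>\<^bsub>Sym_one N\<^esub> n = n" if "n \<in> carrier N" for n
    using that by (simp add: Sym_one_def BijGroup_def)
  show ?thesis
  proof (unfold_locales, goal_cases)
    case (5 a b)
    obtain n h where a: "a = (n, h)" "n \<in> carrier N" "h \<in> carrier H"
      using 5 by (auto simp: semidirect_def)
    obtain m k where b: "b = (m, k)" "m \<in> carrier N" "k \<in> carrier H"
      using 5 by (auto simp: semidirect_def)
    obtain y where y: "y \<in> carrier N" "n \<otimes>\<^bsub>N\<^esub> y = m"
      and yu: "\<And>z. \<lbrakk>z \<in> carrier N; n \<otimes>\<^bsub>N\<^esub> z = m\<rbrakk> \<Longrightarrow> z = y"
      using N.l_div[OF a(2) b(2)] by blast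
    obtain x where x: "x \<in> carrier N" "\<phi> h x = y"
      using bij[OF a(3)] y(1) by (metis bij_betw_imp_surj_on imageE)
    have xu: "z = x" if "z \<in> carrier N" "n \<otimes>\<^bsub>N\<^esub> \<phi> h z = m" for z
      using yu[of "\<phi> h z"] that x bij[OF a(3)] a(3)
      by (auto simp: bij_betw_def inj_on_def)
    show ?case
    proof (rule ex1I[of _ "(x, inv\<^bsub>H\<^esub> h \<otimes>\<^bsub>H\<^esub> k)"], goal_cases)
      case 1
      then show ?case using a b x y by (auto simp: semidirect_def H.m_assoc[symmetric])
    next
      case (2 z)
      then show ?case using a b xu
        by (auto simp: semidirect_def H.inv_solve_left)
    qed
  next
    case (6 a b)
    obtain n h where a: "a = (n, h)" "n \<in> carrier N" "h \<in> carrier H"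
      using 6 by (auto simp: semidirect_def)
    obtain m k where b: "b = (m, k)" "m \<in> carrier N" "k \<in> carrier H"
      using 6 by (auto simp: semidirect_def)
    define g where "g = k \<otimes>\<^bsub>H\<^esub> inv\<^bsub>H\<^esub> h"
    have g: "g \<in> carrier H" "g \<otimes>\<^bsub>H\<^esub> h = k"
      using a b by (auto simp: g_def H.m_assoc)
    have gu: "z = g" if "z \<in> carrier H" "z \<otimes>\<^bsub>H\<^esub> h = k" for z
      using g that a(3) by (metis H.right_cancel)
    obtain x where x: "x \<in> carrier N" "x \<otimes>\<^bsub>N\<^esub> \<phi> g n = m"
      and xu: "\<And>z. \<lbrakk>z \<in> carrier N; z \<otimes>\<^bsub>N\<^esub> \<phi> g n = m\<rbrakk> \<Longrightarrow> z = x"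
      using N.r_div[OF clo[OF g(1) a(2)] b(2)] by blast
    show ?case
    proof (rule ex1I[of _ "(x, g)"], goal_cases)
      case 1
      then show ?case using a b x g by (auto simp: semidirect_def)
    next
      case (2 z)
      then show ?case using a b xu gu by (auto simp: semidirect_def)
    qed
  qed (auto simp: semidirect_def)
qed

end

theory Submission
  imports Defs
begin

text \<open>
  Associativity in the second factor is automatic because \<open>H\<close> is a group, so
  \<open>(x, y)\<close> lies in the right nucleus iff the first components agree, i.e. iff
  \<open>m \<phi>\<^sub>h(n \<phi>\<^sub>k(x)) = (m \<phi>\<^sub>h(n)) \<phi>\<^sub>h\<^sub>k(x)\<close> for all \<open>m, n \<in> N\<close> and \<open>h, k \<in> H\<close>
  (lemma \<open>right_nucleus_semidirect_iff\<close>); in particular \<open>y\<close> is unconstrained.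
  This equation separates into the two conditions of the theorem. Taking \<open>m = 1\<close> says that
  \<open>\<phi>\<^sub>h\<close> maps the product \<open>n \<phi>\<^sub>k(x)\<close> to the product of the images; taking \<open>h = 1\<close> says
  that \<open>\<phi>\<^sub>k(x)\<close> is in the right nucleus of \<open>N\<close>. Conversely, the first condition rewrites the
  left-hand side to \<open>m (\<phi>\<^sub>h(n) \<phi>\<^sub>h\<^sub>k(x))\<close>, and the second, used for \<open>\<phi>\<^sub>h\<^sub>k(x)\<close>,
  reassociates it.
\<close>

lemma hom_Sym_one_closed:
  assumes "loop N" and "\<phi> \<in> hom H (Sym_one N)" and "h \<in> carrier H" and "n \<in> carrier N"
  shows "\<phi> h n \<in> carrier N"
proof -
  have "\<phi> h \<in> Bij (carrier N)"
    using hom_in_carrier[OF assms(2,3)] carrier_Sym_one[OF assms(1)] by auto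
  then show ?thesis
    using assms(4) by (auto simp: Bij_def dest: bij_betwE)
qed

lemma hom_Sym_one_one:
  assumes "loop N" and "group H" and "\<phi> \<in> hom H (Sym_one N)" and "n \<in> carrier N"
  shows "\<phi> \<one>\<^bsub>H\<^esub> n = n"
proof -
  have "\<phi> \<one>\<^bsub>H\<^esub> = \<one>\<^bsub>Sym_one N\<^esub>"
    by (rule hom_one[OF assms(3,2) group_Sym_one[OF assms(1)]])
  then show ?thesis
    using assms(4) by (simp add: Sym_one_def BijGroup_def)
qed

text \<open>
  Comparing \<open>(m, h)((n, k)(x, y))\<close> with \<open>((m, h)(n, k))(x, y)\<close> leaves a single
  equation in \<open>N\<close>, since the second components are equal by associativity of \<open>H\<close>.
\<close>

lemma right_nucleus_semidirect_iff:
  assumes "group H"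
  shows "(x, y) \<in> right_nucleus (semidirect N \<phi> H) \<longleftrightarrow>
    x \<in> carrier N \<and> y \<in> carrier H \<and>
    (\<forall>m\<in>carrier N. \<forall>n\<in>carrier N. \<forall>h\<in>carrier H. \<forall>k\<in>carrier H.
       m \<otimes>\<^bsub>N\<^esub> \<phi> h (n \<otimes>\<^bsub>N\<^esub> \<phi> k x) = (m \<otimes>\<^bsub>N\<^esub> \<phi> h n) \<otimes>\<^bsub>N\<^esub> \<phi> (h \<otimes>\<^bsub>H\<^esub> k) x)"
proof -
  interpret H: group H by fact
  show ?thesis
    by (auto simp: right_nucleus_def semidirect_def H.m_assoc)
qed

theorem theorem3p6:
  fixes N :: "('a, 'm) monoid_scheme" and H :: "('h, 'k) monoid_scheme"
    and \<phi> :: "'h \<Rightarrow> 'a \<Rightarrow> 'a"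
  assumes "loop N" and "group H" and "\<phi> \<in> hom H (Sym_one N)"
  shows "right_nucleus (semidirect N \<phi> H) =
    {(x, y). x \<in> carrier N \<and> y \<in> carrier H \<and>
       (\<forall>h\<in>carrier H. \<forall>h'\<in>carrier H. \<forall>n\<in>carrier N.
          \<phi> h (n \<otimes>\<^bsub>N\<^esub> \<phi> h' x) = \<phi> h n \<otimes>\<^bsub>N\<^esub> \<phi> (h \<otimes>\<^bsub>H\<^esub> h') x \<and>
          \<phi> h x \<in> right_nucleus N)}"
proof -
  interpret N: loop N by fact
  interpret H: group H by fact
  note closed = hom_Sym_one_closed[OF assms(1,3)]
  note one = hom_Sym_one_one[OF assms]
  have separate: "(\<forall>m\<in>carrier N. \<forall>n\<in>carrier N. \<forall>h\<in>carrier H. \<forall>k\<in>carrier H.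
       m \<otimes>\<^bsub>N\<^esub> \<phi> h (n \<otimes>\<^bsub>N\<^esub> \<phi> k x) = (m \<otimes>\<^bsub>N\<^esub> \<phi> h n) \<otimes>\<^bsub>N\<^esub> \<phi> (h \<otimes>\<^bsub>H\<^esub> k) x) \<longleftrightarrow>
     (\<forall>h\<in>carrier H. \<forall>h'\<in>carrier H. \<forall>n\<in>carrier N.
          \<phi> h (n \<otimes>\<^bsub>N\<^esub> \<phi> h' x) = \<phi> h n \<otimes>\<^bsub>N\<^esub> \<phi> (h \<otimes>\<^bsub>H\<^esub> h') x \<and>
          \<phi> h x \<in> right_nucleus N)" (is "?assoc \<longleftrightarrow> ?split")
    if x: "x \<in> carrier N" for x
  proof
    assume assoc: ?assoc
    have "\<phi> h (n \<otimes>\<^bsub>N\<^esub> \<phi> k x) = \<phi> h n \<otimes>\<^bsub>N\<^esub> \<phi> (h \<otimes>\<^bsub>H\<^esub> k) x"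
      if "h \<in> carrier H" "k \<in> carrier H" "n \<in> carrier N" for h k n
      using assoc[rule_format, of "\<one>\<^bsub>N\<^esub>" n h k] that x by (simp add: closed)
    moreover have "\<phi> k x \<in> right_nucleus N" if k: "k \<in> carrier H" for k
    proof -
      have "m \<otimes>\<^bsub>N\<^esub> (n \<otimes>\<^bsub>N\<^esub> \<phi> k x) = (m \<otimes>\<^bsub>N\<^esub> n) \<otimes>\<^bsub>N\<^esub> \<phi> k x"
        if "m \<in> carrier N" "n \<in> carrier N" for m n
        using assoc[rule_format, of m n "\<one>\<^bsub>H\<^esub>" k] that k x by (simp add: closed one)
      then show ?thesis
        using k x by (simp add: right_nucleus_def closed)
    qed
    ultimately show ?split by blast
  next
    assume split: ?split
    show ?assoc
    proof (intro ballI)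
      fix m n h k
      assume mn: "m \<in> carrier N" "n \<in> carrier N" and hk: "h \<in> carrier H" "k \<in> carrier H"
      have nuc: "\<phi> (h \<otimes>\<^bsub>H\<^esub> k) x \<in> right_nucleus N"
        using split hk mn by blast
      have "m \<otimes>\<^bsub>N\<^esub> \<phi> h (n \<otimes>\<^bsub>N\<^esub> \<phi> k x) = m \<otimes>\<^bsub>N\<^esub> (\<phi> h n \<otimes>\<^bsub>N\<^esub> \<phi> (h \<otimes>\<^bsub>H\<^esub> k) x)"
        using split hk mn by simp
      also have "\<dots> = (m \<otimes>\<^bsub>N\<^esub> \<phi> h n) \<otimes>\<^bsub>N\<^esub> \<phi> (h \<otimes>\<^bsub>H\<^esub> k) x"
        using nuc mn hk by (simp add: right_nucleus_def closed)
      finally show "m \<otimes>\<^bsub>N\<^esub> \<phi> h (n \<otimes>\<^bsub>N\<^esub> \<phi> k x) = (m \<otimes>\<^bsub>N\<^esub> \<phi> h n) \<otimes>\<^bsub>N\<^esub> \<phi> (h \<otimes>\<^bsub>H\<^esub> k) x" .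
    qed
  qed
  show ?thesis
    by (simp only: Set.set_eq_iff split_paired_All right_nucleus_semidirect_iff[OF assms(2)]
        mem_Collect_eq case_prod_conv separate simp_thms cong: conj_cong)
qed

end
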